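(* Let $I$ be an open interval in $\mathbb{R}$, and let $f:I\to\mathbb{R}$ be a function. If both one-sided derivatives $\partial^+f(x)$ and $\partial^-f(x)$ exist as finite real numbers for every $x\in I$, then $f\in S^1(I)$.
   Context: For an open interval $I\subset\mathbb{R}$, a function $f:I\to\mathbb{R}$ and a point $x\in I$, the specular derivative of $f$ at $x$ is $$f^{\mathrm{sd}}(x) := \lim_{h \searrow 0} \mathcal{A}(f(x + h) - f(x), f(x) - f(x - h), h)$$ (with $h>0$ small enough that $x\pm h\in I$), where $\mathcal{A}:\mathbb{R}\times\mathbb{R}\times(0,\infty)\to\mathbb{R}$ is $$\mathcal{A}(a, b, c) := \frac{a \sqrt{b^2 + c^2} + b \sqrt{a^2 + c^2}}{c \sqrt{a^2 + c^2} + c \sqrt{b^2 + c^2}}.$$ $f$ is specularly differentiable at $x$ if this limit exists as a finite real number, and specularly differentiable on $I$ if it is so at every point of $I$. $S^0(I)$ is the set of functions $f:I\to\mathbb{R}$ that are specularly differentiable on $I$, and $S^1(I):=C^0(I)\cap S^0(I)$, where $C^0(I)$ is the set of continuous real-valued functions on $I$. The one-sided derivatives are $\partial^+ f(x) := \lim_{h\searrow 0}\frac{f(x+h)-f(x)}{h}$ and $\partial^- f(x) := \lim_{h\searrow 0}\frac{f(x)-f(x-h)}{h}$. *)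

theory Defs
  imports "HOL-Analysis.Analysis"
begin

text \<open>
  A function on an open interval \<open>I\<close> is represented by a function on all of \<open>real\<close> whose values
  outside \<open>I\<close> are arbitrary. Since \<open>I\<close> is open, every limit below, taken at a point of \<open>I\<close>,
  depends only on the values on \<open>I\<close>.
\<close>

definition specular_A :: "real \<Rightarrow> real \<Rightarrow> real \<Rightarrow> real" where
  "specular_A a b c =
     (a * sqrt (b\<^sup>2 + c\<^sup>2) + b * sqrt (a\<^sup>2 + c\<^sup>2)) /
     (c * sqrt (a\<^sup>2 + c\<^sup>2) + c * sqrt (b\<^sup>2 + c\<^sup>2))"

definition has_specular_derivative :: "(real \<Rightarrow> real) \<Rightarrow> real \<Rightarrow> real \<Rightarrow> bool" where
  "has_specular_derivative f L x \<longleftrightarrow>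
     ((\<lambda>h. specular_A (f (x + h) - f x) (f x - f (x - h)) h) \<longlongrightarrow> L) (at_right 0)"

definition specularly_differentiable_at :: "(real \<Rightarrow> real) \<Rightarrow> real \<Rightarrow> bool" where
  "specularly_differentiable_at f x \<longleftrightarrow> (\<exists>L. has_specular_derivative f L x)"

definition specularly_differentiable_on :: "(real \<Rightarrow> real) \<Rightarrow> real set \<Rightarrow> bool" where
  "specularly_differentiable_on f I \<longleftrightarrow> (\<forall>x\<in>I. specularly_differentiable_at f x)"

definition S0 :: "real set \<Rightarrow> (real \<Rightarrow> real) set" where
  "S0 I = {f. specularly_differentiable_on f I}"

definition C0 :: "real set \<Rightarrow> (real \<Rightarrow> real) set" where
  "C0 I = {f. continuous_on I f}"

definition S1 :: "real set \<Rightarrow> (real \<Rightarrow> real) set" where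
  "S1 I = C0 I \<inter> S0 I"

definition has_right_derivative :: "(real \<Rightarrow> real) \<Rightarrow> real \<Rightarrow> real \<Rightarrow> bool" where
  "has_right_derivative f D x \<longleftrightarrow> ((\<lambda>h. (f (x + h) - f x) / h) \<longlongrightarrow> D) (at_right 0)"

definition has_left_derivative :: "(real \<Rightarrow> real) \<Rightarrow> real \<Rightarrow> real \<Rightarrow> bool" where
  "has_left_derivative f D x \<longleftrightarrow> ((\<lambda>h. (f x - f (x - h)) / h) \<longlongrightarrow> D) (at_right 0)"

lemma has_right_derivative_iff:
  "has_right_derivative f D x \<longleftrightarrow> (f has_real_derivative D) (at_right x)"
  unfolding has_right_derivative_def has_field_derivative_iff
  by (subst (2) filterlim_at_right_to_0) (simp add: add.commute)

lemma has_left_derivative_iff: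
  "has_left_derivative f D x \<longleftrightarrow> (f has_real_derivative D) (at_left x)"
proof -
  have eq: "(f (- (h + - x)) - f x) / (- (h + - x) - x) = (f x - f (x - h)) / h" for h
    by (simp add: divide_simps)
  have "((\<lambda>y. (f y - f x) / (y - x)) \<longlongrightarrow> D) (at_left x) \<longleftrightarrow>
        ((\<lambda>y. (f (- y) - f x) / (- y - x)) \<longlongrightarrow> D) (at_right (- x))"
    by (rule filterlim_at_left_to_right)
  also have "\<dots> \<longleftrightarrow> ((\<lambda>h. (f (- (h + - x)) - f x) / (- (h + - x) - x)) \<longlongrightarrow> D) (at_right 0)"
    by (rule filterlim_at_right_to_0)
  finally show ?thesis
    unfolding has_left_derivative_def has_field_derivative_iff eq by (rule sym)
qed

end

theory Submission
  imports Defs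
begin

text \<open>
  The function \<open>specular_A\<close> is positively homogeneous of degree \<open>0\<close>: scaling all three arguments
  by \<open>h > 0\<close> multiplies numerator and denominator by \<open>h\<^sup>2\<close>. Dividing by the step size \<open>h\<close> therefore
  turns the expression under the specular limit into \<open>specular_A p q 1\<close>, where \<open>p\<close> and \<open>q\<close> are the
  forward and backward difference quotients (\<open>specular_A_difference_quotients\<close>). The denominator of
  \<open>specular_A p q 1\<close> never vanishes, so this is a continuous function of \<open>(p, q)\<close>, and the
  convergence of the two difference quotients to one-sided derivatives \<open>\<alpha>\<close> and \<open>\<beta>\<close> gives the
  specular derivative \<open>specular_A \<alpha> \<beta> 1\<close>. Continuity of \<open>f\<close> holds because a one-sided derivative
  forces continuity from that side, and continuity from both sides is continuity. Both arguments are
  local, at a single point.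
\<close>

lemma specular_A_scale:
  assumes "h > 0"
  shows "specular_A (h * a) (h * b) (h * c) = specular_A a b c"
proof -
  have sqrt_scale: "sqrt ((h * u)\<^sup>2 + (h * v)\<^sup>2) = h * sqrt (u\<^sup>2 + v\<^sup>2)" for u v
  proof -
    have "(h * u)\<^sup>2 + (h * v)\<^sup>2 = h\<^sup>2 * (u\<^sup>2 + v\<^sup>2)"
      by (simp add: power_mult_distrib distrib_left)
    then show ?thesis
      using assms by (simp only: real_sqrt_mult real_sqrt_abs abs_of_pos)
  qed
  define N where "N = a * sqrt (b\<^sup>2 + c\<^sup>2) + b * sqrt (a\<^sup>2 + c\<^sup>2)"
  define M where "M = c * sqrt (a\<^sup>2 + c\<^sup>2) + c * sqrt (b\<^sup>2 + c\<^sup>2)"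
  have "specular_A (h * a) (h * b) (h * c) = (h\<^sup>2 * N) / (h\<^sup>2 * M)"
    unfolding specular_A_def sqrt_scale N_def M_def
    by (simp add: algebra_simps power2_eq_square)
  also have "\<dots> = N / M"
    using assms by simp
  finally show ?thesis
    by (simp add: specular_A_def N_def M_def)
qed

corollary specular_A_difference_quotients:
  assumes "h > 0"
  shows "specular_A a b h = specular_A (a / h) (b / h) 1"
  using specular_A_scale[OF assms, of "a / h" "b / h" 1] assms by simp

lemma tendsto_specular_A:
  assumes "(p \<longlongrightarrow> a) F" and "(q \<longlongrightarrow> b) F"
  shows "((\<lambda>h. specular_A (p h) (q h) 1) \<longlongrightarrow> specular_A a b 1) F"
proof -
  have "sqrt (a\<^sup>2 + 1) + sqrt (b\<^sup>2 + 1) > 0"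
    by (intro add_pos_pos) (simp_all add: add_nonneg_pos)
  then show ?thesis
    unfolding specular_A_def by (intro tendsto_intros assms) simp
qed

lemma has_specular_derivative_if_one_sided:
  assumes "has_right_derivative f a x" and "has_left_derivative f b x"
  shows "has_specular_derivative f (specular_A a b 1) x"
proof -
  have "((\<lambda>h. specular_A ((f (x + h) - f x) / h) ((f x - f (x - h)) / h) 1)
          \<longlongrightarrow> specular_A a b 1) (at_right 0)"
    using assms unfolding has_right_derivative_def has_left_derivative_def
    by (rule tendsto_specular_A)
  moreover have "\<forall>\<^sub>F h in at_right 0.
      specular_A ((f (x + h) - f x) / h) ((f x - f (x - h)) / h) 1
        = specular_A (f (x + h) - f x) (f x - f (x - h)) h"
    using eventually_at_right_less[of "0::real"]
    by eventually_elim (rule specular_A_difference_quotients[symmetric])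
  ultimately show ?thesis
    unfolding has_specular_derivative_def by (rule Lim_transform_eventually)
qed

lemma isCont_if_one_sided_derivatives:
  assumes "has_right_derivative f a x" and "has_left_derivative f b x"
  shows "isCont f x"
  using assms unfolding has_right_derivative_iff has_left_derivative_iff continuous_at_split
  by (blast intro: DERIV_continuous)

theorem proposition2p20:
  fixes I :: "real set" and f :: "real \<Rightarrow> real"
  assumes "open I" and "is_interval I"
    and "\<And>x. x \<in> I \<Longrightarrow> \<exists>D. has_right_derivative f D x"
    and "\<And>x. x \<in> I \<Longrightarrow> \<exists>D. has_left_derivative f D x"
  shows "f \<in> S1 I"
proof -
  have "isCont f x \<and> specularly_differentiable_at f x" if "x \<in> I" for x
    using assms(3,4)[OF that] unfolding specularly_differentiable_at_def
    by (blast intro: isCont_if_one_sided_derivatives has_specular_derivative_if_one_sided)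
  then show ?thesis
    by (auto simp: S1_def C0_def S0_def specularly_differentiable_on_def
        intro: continuous_at_imp_continuous_on)
qed

end
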